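(* Let $k$ be a positive integer and define $g_k(n)$ by $$\sum_{n=0}^{\infty} g_k(n)q^n=\frac{(-q;q)_\infty}{(q;q)_\infty}\,\phi(q^k),\qquad \phi(q)=\sum_{m=-\infty}^{\infty}q^{m^2}.$$ Then $g_k(n)$ equals the number of overpartitions of $n$ into parts such that no part is congruent to $0$ modulo $2k$ and parts congruent to $k \pmod{2k}$ have two colours.
   Context: For $|q|<1$, $(A;q)_\infty=\prod_{j\ge0}(1-Aq^j)$ and $(A_1,\dots,A_r;q)_\infty=\prod_i(A_i;q)_\infty$. An overpartition of $n$ is a partition of $n$ in which the first occurrence of each part may be overlined; its generating function is $(-q;q)_\infty/(q;q)_\infty$. "Parts congruent to $k\pmod{2k}$ have two colours" means each such part may appear in two distinguishable copies (colours), each copy being subject to the overpartition rule. *)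

theory Defs
  imports "HOL-Analysis.Analysis" "HOL-Library.Multiset"
begin

definition qpoch_inf :: "complex \<Rightarrow> complex \<Rightarrow> complex" where
  "qpoch_inf A q = (\<Prod>j. 1 - A * q ^ j)"

definition theta_phi :: "complex \<Rightarrow> complex" where
  "theta_phi q = (\<Sum>\<^sub>\<infinity>m::int. q ^ nat (m\<^sup>2))"

text \<open>A coloured part is a pair (v, c): v is the size, c the colour
  (False = first colour, True = second colour).  Admissible parts: v > 0,
  v not divisible by 2k, and the second colour is only allowed when v = k mod 2k.\<close>
definition admissible_part :: "nat \<Rightarrow> nat \<times> bool \<Rightarrow> bool" where
  "admissible_part k p = (0 < fst p \<and> \<not> (2 * k) dvd fst p \<and>
                          (snd p \<longrightarrow> fst p mod (2 * k) = k))"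

text \<open>Overpartitions of n of the required kind: a multiset M of coloured parts
  together with the set Ov of part kinds whose first occurrence is overlined.\<close>
definition coloured_overpartitions :: "nat \<Rightarrow> nat \<Rightarrow> ((nat \<times> bool) multiset \<times> (nat \<times> bool) set) set" where
  "coloured_overpartitions k n =
     {(M, Ov). (\<forall>p\<in>#M. admissible_part k p) \<and> Ov \<subseteq> set_mset M \<and> (\<Sum>p\<in>#M. fst p) = n}"

end

theory Submission
  imports Defs "HOL-Complex_Analysis.Laurent_Convergence"
begin

text \<open>
  A part of size \<open>v\<close> contributes the factor \<open>(1 + q\<^sup>v) / (1 - q\<^sup>v)\<close>, so with \<open>Q = q\<^sup>k\<close> the
  coloured overpartitions have the generating function
  \<open>(-q;q)/(q;q) \<cdot> (Q\<^sup>2;Q\<^sup>2)/(-Q\<^sup>2;Q\<^sup>2) \<cdot> (-Q;Q\<^sup>2)/(Q;Q\<^sup>2)\<close>: remove the multiples of \<open>2k\<close> once and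
  duplicate the odd multiples of \<open>k\<close>. Euler's identity \<open>(Q\<^sup>2;Q\<^sup>4) (-Q\<^sup>2;Q\<^sup>2) = 1\<close> turns the last two
  factors into \<open>(Q\<^sup>2;Q\<^sup>2) (-Q;Q\<^sup>2)\<^sup>2\<close>, which is \<open>\<phi>(Q)\<close> by the Jacobi triple product at \<open>z = 1\<close>. The
  latter is the limit \<open>n \<rightarrow> \<infinity>\<close> of the q-binomial theorem for \<open>\<Prod>j<2n. 1 + x p\<^sup>j\<close>, where \<open>p = q\<^sup>2\<close> and
  \<open>x = q / p\<^sup>n\<close>.
\<close>

section \<open>Dominated convergence for unordered sums\<close>

text \<open>An absolutely convergent unordered sum over \<open>A\<close> is an integral against the
  counting measure on \<open>A\<close>, so the dominated convergence theorem for integrals applies.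
  The majorant \<open>h\<close> supplies the absolute convergence needed to pass between
  \<open>infsum\<close> and the integral.\<close>

lemma infsum_dominated_convergence:
  fixes f :: "nat \<Rightarrow> 'a \<Rightarrow> 'b::{banach, second_countable_topology}"
  assumes lim: "\<And>x. x \<in> A \<Longrightarrow> (\<lambda>n. f n x) \<longlonglongrightarrow> g x"
    and bound: "\<And>n x. x \<in> A \<Longrightarrow> norm (f n x) \<le> h x"
    and h: "h summable_on A"
  shows "(\<lambda>n. infsum (f n) A) \<longlonglongrightarrow> infsum g A"
proof -
  have g_bound: "norm (g x) \<le> h x" if "x \<in> A" for x
    using lim[OF that] bound[OF that] by (intro Lim_bounded[OF tendsto_norm]) auto
  have f_abs: "(\<lambda>x. norm (f n x)) summable_on A" for n
    by (rule Infinite_Sum.abs_summable_on_comparison_test'[OF h bound])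
  have g_abs: "(\<lambda>x. norm (g x)) summable_on A"
    by (rule Infinite_Sum.abs_summable_on_comparison_test'[OF h g_bound])
  have "(\<lambda>x. norm (h x)) summable_on A"
    using h summable_on_iff_abs_summable_on_real by blast
  then have "integrable (count_space A) h"
    using abs_summable_equivalent[of h A] by (simp add: Infinite_Set_Sum.abs_summable_on_def)
  then have "(\<lambda>n. LINT x|count_space A. f n x) \<longlonglongrightarrow> (LINT x|count_space A. g x)"
    by (rule integral_dominated_convergence[rotated 2])
       (use lim bound in \<open>auto simp: AE_count_space\<close>)
  then show ?thesis
    using f_abs g_abs by (simp add: abs_summable_equivalent infsetsum_def flip: infsetsum_infsum)
qed

section \<open>Finite and infinite q-Pochhammer symbols\<close>

text \<open>The truncation \<open>(a;q)_n\<close> of \<open>qpoch_inf\<close>. Identities between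
  infinite products are first proved for these truncations and then carried to the limit.\<close>

definition qpoch :: "'a::comm_ring_1 \<Rightarrow> 'a \<Rightarrow> nat \<Rightarrow> 'a" where
  "qpoch a q n = (\<Prod>j<n. 1 - a * q ^ j)"

lemma qpoch_0 [simp]: "qpoch a q 0 = 1"
  by (simp add: qpoch_def)

lemma qpoch_Suc: "qpoch a q (Suc n) = qpoch a q n * (1 - a * q ^ n)"
  by (simp add: qpoch_def)

lemma qpoch_add: "qpoch a q (m + n) = qpoch a q m * qpoch (a * q ^ m) q n"
  by (induction n) (simp_all add: qpoch_Suc power_add mult.assoc)

lemma norm_mult_power_less_1:
  fixes a q :: "'a::real_normed_field"
  assumes "norm a < 1" "norm q < 1"
  shows "norm (a * q ^ j) < 1"
proof -
  have "norm q ^ j \<le> 1" using assms by (simp add: power_le_one)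
  then have "norm a * norm q ^ j \<le> norm a * 1" by (intro mult_left_mono) auto
  then show ?thesis using assms by (simp add: norm_mult norm_power)
qed

lemma one_minus_mult_power_nonzero:
  fixes a q :: "'a::real_normed_field"
  assumes "norm a < 1" "norm q < 1"
  shows "1 - a * q ^ j \<noteq> 0"
proof
  assume "1 - a * q ^ j = 0"
  then have "a * q ^ j = 1" by simp
  then show False using norm_mult_power_less_1[OF assms, of j] by (metis norm_one less_irrefl)
qed

lemma qpoch_nonzero:
  fixes a q :: "'a::real_normed_field"
  assumes "norm a < 1" "norm q < 1"
  shows "qpoch a q n \<noteq> 0"
  using one_minus_mult_power_nonzero[OF assms] by (simp add: qpoch_def)

lemma convergent_prod_qpoch:
  fixes a q :: complex
  assumes "norm q < 1"
  shows "convergent_prod (\<lambda>j. 1 - a * q ^ j)"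
proof -
  have "summable (\<lambda>j. norm a * norm q ^ j)"
    using assms by (intro summable_mult summable_geometric) auto
  then show ?thesis
    by (intro abs_convergent_prod_imp_convergent_prod)
       (simp add: abs_convergent_prod_conv_summable norm_mult norm_power)
qed

lemma qpoch_LIMSEQ:
  fixes a q :: complex
  assumes "norm q < 1"
  shows "qpoch a q \<longlonglongrightarrow> qpoch_inf a q"
proof -
  \<comment> \<open>Partial products in \<open>convergent_prod_LIMSEQ\<close> run over
    \<open>{..n}\<close> and so have \<open>n + 1\<close> factors; hence the index shift.\<close>
  have "(\<lambda>n. qpoch a q (Suc n)) \<longlonglongrightarrow> qpoch_inf a q"
    using convergent_prod_LIMSEQ[OF convergent_prod_qpoch[OF assms, of a]]
    by (simp add: qpoch_def qpoch_inf_def lessThan_Suc_atMost)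
  then show ?thesis by (rule LIMSEQ_imp_Suc)
qed

lemma qpoch_inf_nonzero:
  fixes a q :: complex
  assumes "norm a < 1" "norm q < 1"
  shows "qpoch_inf a q \<noteq> 0"
  unfolding qpoch_inf_def
  using prodinf_nonzero[OF convergent_prod_qpoch] one_minus_mult_power_nonzero assms by blast

text \<open>The exponents \<open>1, ..., 2n\<close> are split into odd and even ones.\<close>

lemma qpoch_double:
  "qpoch q q (2 * n) = qpoch q (q\<^sup>2) n * qpoch (q\<^sup>2) (q\<^sup>2) n"
  by (induction n) (simp_all add: qpoch_Suc algebra_simps power2_eq_square power_mult_distrib
      power_mult mult_2_right power_add)

text \<open>Factorwise difference of squares:
  \<open>1 - q^(2i) = (1 - q^i)(1 + q^i)\<close>.\<close>

lemma qpoch_square: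
  "qpoch (q\<^sup>2) (q\<^sup>2) n = qpoch q q n * qpoch (- q) q n"
  by (induction n) (simp_all add: qpoch_Suc algebra_simps power2_eq_square power_mult_distrib)

text \<open>Let \<open>n \<rightarrow> \<infinity>\<close> in \<open>(q;q)\<^bsub>2n\<^esub> = (q;q\<^sup>2)\<^bsub>n\<^esub> (q;q)\<^bsub>n\<^esub> (-q;q)\<^bsub>n\<^esub>\<close> and cancel \<open>(q;q)\<close>.\<close>

lemma euler_odd_distinct:
  fixes q :: complex
  assumes q: "norm q < 1"
  shows "qpoch_inf q (q\<^sup>2) * qpoch_inf (- q) q = 1"
proof -
  have q2: "norm (q\<^sup>2) < 1"
    using q by (simp add: norm_power power_less_one_iff)
  have "(\<lambda>n. qpoch q q (2 * n)) \<longlonglongrightarrow> qpoch_inf q q"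
    using qpoch_LIMSEQ[OF q, of q] 
    by (rule filterlim_compose) (auto intro!: filterlim_subseq strict_monoI)
  moreover have "(\<lambda>n. qpoch q q (2 * n)) \<longlonglongrightarrow>
      qpoch_inf q (q\<^sup>2) * (qpoch_inf q q * qpoch_inf (- q) q)"
    unfolding qpoch_double qpoch_square by (intro tendsto_mult qpoch_LIMSEQ q q2)
  ultimately have "qpoch_inf q q = qpoch_inf q (q\<^sup>2) * (qpoch_inf q q * qpoch_inf (- q) q)"
    by (rule LIMSEQ_unique)
  then show ?thesis using qpoch_inf_nonzero[OF q q] by simp
qed

text \<open>Again a difference of squares, now over the odd exponents \<open>2j + 1\<close>. Its
  limit links the left-hand product of Euler's identity at \<open>q^2\<close> to products with base
  \<open>q^2\<close>.\<close>

lemma qpoch_plus_minus: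
  "qpoch (q\<^sup>2) ((q\<^sup>2)\<^sup>2) n = qpoch q (q\<^sup>2) n * qpoch (- q) (q\<^sup>2) n"
  by (induction n) (simp_all add: qpoch_Suc algebra_simps power2_eq_square power_mult_distrib)

lemma qpoch_inf_plus_minus:
  fixes q :: complex
  assumes q: "norm q < 1"
  shows "qpoch_inf (q\<^sup>2) ((q\<^sup>2)\<^sup>2) = qpoch_inf q (q\<^sup>2) * qpoch_inf (- q) (q\<^sup>2)"
proof (rule LIMSEQ_unique)
  have q2: "norm (q\<^sup>2) < 1" and q4: "norm ((q\<^sup>2)\<^sup>2) < 1"
    using q by (simp_all add: norm_power power_less_one_iff)
  show "qpoch (q\<^sup>2) ((q\<^sup>2)\<^sup>2) \<longlonglongrightarrow> qpoch_inf (q\<^sup>2) ((q\<^sup>2)\<^sup>2)"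
    by (rule qpoch_LIMSEQ[OF q4])
  show "qpoch (q\<^sup>2) ((q\<^sup>2)\<^sup>2) \<longlonglongrightarrow> qpoch_inf q (q\<^sup>2) * qpoch_inf (- q) (q\<^sup>2)"
    unfolding qpoch_plus_minus by (intro tendsto_mult qpoch_LIMSEQ q2)
qed

section \<open>The theta product\<close>

text \<open>The Gaussian binomial coefficient, given by its Pascal rule instead of a quotient so
  that no denominator has to be nonzero.\<close>

fun qbinomial :: "'a::comm_ring_1 \<Rightarrow> nat \<Rightarrow> nat \<Rightarrow> 'a" where
  "qbinomial p n 0 = 1"
| "qbinomial p 0 (Suc i) = 0"
| "qbinomial p (Suc n) (Suc i) = qbinomial p n i + p ^ Suc i * qbinomial p n (Suc i)"

lemma qbinomial_eq_0: "n < i \<Longrightarrow> qbinomial p n i = 0"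
  by (induction p n i rule: qbinomial.induct) auto

lemma qbinomial_qpoch:
  "i \<le> n \<Longrightarrow> qbinomial p n i * (qpoch p p i * qpoch p p (n - i)) = qpoch p p n"
proof (induction p n i rule: qbinomial.induct)
  case (3 p n i)
  show ?case
  proof (cases "i = n")
    case True
    with 3 show ?thesis by (simp add: qbinomial_eq_0 qpoch_Suc algebra_simps)
  next
    case False
    with 3 obtain d where n: "n = Suc (i + d)"
      by (metis Suc_le_mono le_neq_implies_less less_imp_Suc_add)
    from 3 have IH1: "qbinomial p n i * (qpoch p p i * qpoch p p (Suc d)) = qpoch p p n"
      and IH2: "qbinomial p n (Suc i) * (qpoch p p (Suc i) * qpoch p p d) = qpoch p p n"
      by (simp_all add: n Suc_diff_le)
    \<comment> \<open>The weights of the two induction hypotheses add up to the new factor: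
      \<open>(1 - p^(i+1)) + p^(i+1) (1 - p^(d+1)) = 1 - p^(n+1)\<close>, as
      \<open>n + 1 = (i + 1) + (d + 1)\<close>.\<close>
    have "qbinomial p (Suc n) (Suc i) * (qpoch p p (Suc i) * qpoch p p (Suc d)) =
        (1 - p * p ^ i) * (qbinomial p n i * (qpoch p p i * qpoch p p (Suc d))) +
        p ^ Suc i * (1 - p * p ^ d) * (qbinomial p n (Suc i) * (qpoch p p (Suc i) * qpoch p p d))"
      by (simp add: qpoch_Suc algebra_simps)
    also have "\<dots> = qpoch p p (Suc n)"
      unfolding IH1 IH2 by (simp add: qpoch_Suc n algebra_simps power_add)
    finally show ?thesis by (simp add: n)
  qed
qed auto

text \<open>Peeling off the factor \<open>j = 0\<close> replaces \<open>x\<close> by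
  \<open>x * p\<close>, so the induction needs \<open>x\<close> arbitrary. Multiplying the expansion
  by \<open>1 + x\<close> and collecting powers of \<open>x\<close> then reproduces the Pascal
  rule.\<close>

lemma qbinomial_theorem:
  "qpoch (- x) p n = (\<Sum>i\<le>n. qbinomial p n i * p ^ (i choose 2) * x ^ i)"
proof (induction n arbitrary: x)
  case (Suc n)
  let ?t = "\<lambda>i. qbinomial p n i * p ^ (i choose 2) * (x * p) ^ i"
  have ext: "(\<Sum>i\<le>n. ?t i) = 1 + (\<Sum>i\<le>n. ?t (Suc i))"
  proof -
    have "(\<Sum>i\<le>n. ?t i) = (\<Sum>i\<le>Suc n. ?t i)" by (simp add: qbinomial_eq_0)
    also have "\<dots> = 1 + (\<Sum>i\<le>n. ?t (Suc i))"
      by (subst sum.atMost_Suc_shift) (simp add: numeral_2_eq_2)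
    finally show ?thesis .
  qed
  have "qpoch (- x) p (Suc n) = (1 + x) * qpoch (- (x * p)) p n"
    unfolding qpoch_def by (subst prod.lessThan_Suc_shift) (simp add: algebra_simps)
  also have "\<dots> = (\<Sum>i\<le>n. ?t i) + x * (\<Sum>i\<le>n. ?t i)"
    by (simp add: Suc algebra_simps)
  also have "\<dots> = 1 + (\<Sum>i\<le>n. ?t (Suc i) + x * ?t i)"
    by (subst ext) (simp add: sum.distrib sum_distrib_left algebra_simps)
  also have "(\<Sum>i\<le>n. ?t (Suc i) + x * ?t i) =
      (\<Sum>i\<le>n. qbinomial p (Suc n) (Suc i) * p ^ (Suc i choose 2) * x ^ Suc i)"
    by (intro sum.cong) (simp_all add: numeral_2_eq_2 power_add power_mult_distrib algebra_simps)
  also have "1 + \<dots> = (\<Sum>i\<le>Suc n. qbinomial p (Suc n) i * p ^ (i choose 2) * x ^ i)"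
    by (subst sum.atMost_Suc_shift) (simp add: numeral_2_eq_2)
  finally show ?case .
qed (simp add: numeral_2_eq_2)

lemma sum_odd_lessThan: "(\<Sum>j<n. 2 * j + 1) = n\<^sup>2" for n :: nat
  by (induction n) (simp_all add: power2_eq_square)

text \<open>A finite Jacobi triple product at \<open>z = 1\<close>. With \<open>x = q / p^n\<close>
  the last \<open>n\<close> of the \<open>2n\<close> factors form \<open>(-q;q^2)_n\<close>, and the
  first \<open>n\<close> form the same product up to the power \<open>q^(n^2)\<close>; the
  q-binomial theorem expands the whole.\<close>

lemma theta_finite_sum:
  fixes q :: "'a::field"
  assumes q: "q \<noteq> 0"
  shows "(qpoch (- q) (q\<^sup>2) n)\<^sup>2 =
    (\<Sum>m=-int n..int n. q ^ nat (m\<^sup>2) * qbinomial (q\<^sup>2) (2 * n) (nat (int n + m)))"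
proof -
  define p where "p = q\<^sup>2"
  have p: "p \<noteq> 0" using q by (simp add: p_def)
  have pq: "p ^ j = q ^ (2 * j)" for j by (simp add: p_def power_mult)
  have "qpoch (- (q / p ^ n)) p (2 * n) = (\<Prod>j<n. 1 + q / p ^ n * p ^ j) * qpoch (- q) p n"
    using p by (simp add: mult_2 qpoch_add) (simp add: qpoch_def)
  \<comment> \<open>In reversed order the j-th factor is \<open>1 + q^(-(2j+1))\<close>, which is
    \<open>(1 + q^(2j+1)) / q^(2j+1)\<close>; the denominators multiply to
    \<open>q^(n^2)\<close>.\<close>
  also have "(\<Prod>j<n. 1 + q / p ^ n * p ^ j) = (\<Prod>j<n. 1 + q / p ^ n * p ^ (n - Suc j))"
    by (rule prod.nat_diff_reindex[symmetric])
  also have "\<dots> = (\<Prod>j<n. (1 + q * p ^ j) / q ^ (2 * j + 1))"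
  proof (rule prod.cong)
    fix j assume "j \<in> {..<n}"
    then have "p ^ n = p ^ (n - Suc j) * p ^ Suc j" by (simp flip: power_add power_Suc)
    then have "q / p ^ n * p ^ (n - Suc j) = q / p ^ Suc j" using p by simp
    also have "\<dots> = 1 / q ^ (2 * j + 1)" using q by (simp add: p_def power_mult field_simps power2_eq_square)
    finally show "1 + q / p ^ n * p ^ (n - Suc j) = (1 + q * p ^ j) / q ^ (2 * j + 1)"
      using q by (simp add: pq field_simps)
  qed simp
  also have "\<dots> = qpoch (- q) p n / q ^ n\<^sup>2"
    by (simp only: qpoch_def prod_dividef sum_odd_lessThan[symmetric] power_sum) simp
  finally have "(qpoch (- q) p n)\<^sup>2 = q ^ n\<^sup>2 * qpoch (- (q / p ^ n)) p (2 * n)"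
    using q by (simp add: power2_eq_square)
  also have "\<dots> = (\<Sum>i\<le>2*n. q ^ nat ((int i - int n)\<^sup>2) * qbinomial p (2 * n) i)"
    unfolding qbinomial_theorem sum_distrib_left
  proof (rule sum.cong)
    fix i assume "i \<in> {..2 * n}"
    \<comment> \<open>The i-th term carries the exponent
      \<open>n^2 + 2 (i choose 2) + i - 2ni = (i - n)^2\<close>. The facts \<open>e1\<close> and
      \<open>e2\<close> state this additively, avoiding truncated subtraction.\<close>
    have "int (nat ((int i - int n)\<^sup>2)) = (int i - int n)\<^sup>2" by simp
    then have "int (n\<^sup>2 + i\<^sup>2) = int (2 * n * i + nat ((int i - int n)\<^sup>2))"
      unfolding of_nat_add by (simp only:) (simp add: power2_eq_square algebra_simps)
    then have e1: "n\<^sup>2 + i\<^sup>2 = 2 * n * i + nat ((int i - int n)\<^sup>2)"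
      using of_nat_eq_iff by blast
    have e2: "2 * (i choose 2) + i = i\<^sup>2"
      by (induction i) (simp_all add: numeral_2_eq_2)
    have "q ^ n\<^sup>2 * (p ^ (i choose 2) * (q / p ^ n) ^ i) =
        q ^ n\<^sup>2 * q ^ (2 * (i choose 2) + i) / q ^ (2 * n * i)"
      using q by (simp add: pq power_add power_divide flip: power_mult)
    also have "\<dots> = q ^ nat ((int i - int n)\<^sup>2)"
      using q unfolding e2 power_add[symmetric] e1 by (simp add: power_add)
    finally show "q ^ n\<^sup>2 * (qbinomial p (2 * n) i * p ^ (i choose 2) * (q / p ^ n) ^ i) =
        q ^ nat ((int i - int n)\<^sup>2) * qbinomial p (2 * n) i"
      by (simp add: algebra_simps)
  qed simp
  also have "\<dots> = (\<Sum>m=-int n..int n. q ^ nat (m\<^sup>2) * qbinomial p (2 * n) (nat (int n + m)))"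
    by (rule sum.reindex_bij_witness[of _ "\<lambda>m. nat (int n + m)" "\<lambda>i. int i - int n"]) auto
  finally show ?thesis by (simp add: p_def)
qed

section \<open>Passage from the finite identity to the theta series\<close>

text \<open>Since \<open>|m| <= m^2\<close>, geometric series over the two half-lines dominate. This
  provides the majorant for the limit of the finite sums.\<close>

lemma summable_on_theta:
  fixes r :: real
  assumes "0 \<le> r" "r < 1"
  shows "(\<lambda>m::int. r ^ nat (m\<^sup>2)) summable_on UNIV"
proof -
  have geo: "(\<lambda>n::nat. r ^ n) summable_on UNIV"
    using assms by (simp add: summable_on_UNIV_nonneg_real_iff summable_geometric)
  have "(\<lambda>m::int. r ^ nat \<bar>m\<bar>) summable_on range int"
    by (subst summable_on_reindex) (auto simp: o_def geo)
  moreover have "(\<lambda>m::int. r ^ nat \<bar>m\<bar>) summable_on range (\<lambda>n. - int n)"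
    by (subst summable_on_reindex) (auto simp: o_def geo inj_on_def)
  ultimately have "(\<lambda>m::int. r ^ nat \<bar>m\<bar>) summable_on (range int \<union> range (\<lambda>n. - int n))"
    by (rule summable_on_union)
  also have "range int \<union> range (\<lambda>n. - int n) = UNIV"
  proof -
    have "m \<in> range int \<union> range (\<lambda>n. - int n)" for m
      by (cases m rule: int_cases2) auto
    then show ?thesis by blast
  qed
  finally have *: "(\<lambda>m::int. r ^ nat \<bar>m\<bar>) summable_on UNIV" .
  show ?thesis
  proof (rule summable_on_comparison_test[OF *])
    fix m :: int
    have "\<bar>m\<bar> \<le> m\<^sup>2"
      by (metis abs_of_nonneg abs_ge_zero power2_abs self_le_power zero_less_numeral
          int_one_le_iff_zero_less less_le zero_power2)
    then show "r ^ nat (m\<^sup>2) \<le> r ^ nat \<bar>m\<bar>"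
      using assms by (intro power_decreasing) auto
  qed (use assms in auto)
qed

text \<open>\<open>(p;p)_n\<close> has a nonzero limit, so it and its inverse are bounded; the
  quotient formula turns this into a bound uniform in both indices, as domination requires.\<close>

lemma qbinomial_bounded:
  fixes p :: complex
  assumes p: "norm p < 1"
  obtains C where "\<And>n i. norm (qbinomial p n i) \<le> C" "0 \<le> C"
proof -
  have lim: "qpoch p p \<longlonglongrightarrow> qpoch_inf p p" by (rule qpoch_LIMSEQ[OF p])
  have nz: "qpoch p p n \<noteq> 0" for n by (rule qpoch_nonzero[OF p p])
  from lim have "Bseq (qpoch p p)" by (intro convergent_imp_Bseq convergentI)
  then obtain B where B: "\<And>n. norm (qpoch p p n) \<le> B" and "0 < B" by (auto simp: Bseq_def)
  have "(\<lambda>n. inverse (qpoch p p n)) \<longlonglongrightarrow> inverse (qpoch_inf p p)"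
    by (intro tendsto_inverse lim qpoch_inf_nonzero p)
  then have "Bseq (\<lambda>n. inverse (qpoch p p n))" by (intro convergent_imp_Bseq convergentI)
  then obtain D where D: "\<And>n. norm (inverse (qpoch p p n)) \<le> D" and "0 < D"
    by (auto simp: Bseq_def)
  have "norm (qbinomial p n i) \<le> B * (D * D)" for n i
  proof (cases "i \<le> n")
    case True
    have "qbinomial p n i =
        qpoch p p n * (inverse (qpoch p p i) * inverse (qpoch p p (n - i)))"
      using qbinomial_qpoch[OF True, of p] nz[of i] nz[of "n - i"] by (simp add: field_simps)
    then show ?thesis
      using B D \<open>0 < B\<close> \<open>0 < D\<close> by (simp only: norm_mult) (intro mult_mono; simp)
  next
    case False
    then show ?thesis using \<open>0 < B\<close> \<open>0 < D\<close> by (simp add: qbinomial_eq_0)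
  qed
  then show ?thesis using that \<open>0 < B\<close> \<open>0 < D\<close> by fastforce
qed

text \<open>In the quotient formula the three lengths \<open>2n\<close>, \<open>n + m\<close>,
  \<open>n - m\<close> all tend to infinity, leaving \<open>(p;p) / (p;p)^2\<close>.\<close>

lemma qbinomial_central_LIMSEQ:
  fixes p :: complex
  assumes p: "norm p < 1"
  shows "(\<lambda>n. qbinomial p (2 * n) (nat (int n + m))) \<longlonglongrightarrow> 1 / qpoch_inf p p"
proof -
  have lim: "qpoch p p \<longlonglongrightarrow> qpoch_inf p p" by (rule qpoch_LIMSEQ[OF p])
  have nz: "qpoch p p n \<noteq> 0" for n by (rule qpoch_nonzero[OF p p])
  have sub: "filterlim (\<lambda>n. nat (int n + c)) at_top sequentially" for c
    unfolding filterlim_at_top eventually_sequentially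
  proof safe
    fix Z
    show "\<exists>N. \<forall>n\<ge>N. Z \<le> nat (int n + c)" by (rule exI[of _ "Z + nat \<bar>c\<bar>"]) auto
  qed
  have sub2: "filterlim (\<lambda>n::nat. 2 * n) at_top sequentially"
    by (auto intro!: filterlim_subseq strict_monoI)
  have "(\<lambda>n. qpoch p p (2 * n) / (qpoch p p (nat (int n + m)) * qpoch p p (nat (int n + (- m)))))
      \<longlonglongrightarrow> qpoch_inf p p / (qpoch_inf p p * qpoch_inf p p)"
    by (intro tendsto_divide tendsto_mult filterlim_compose[OF lim] sub sub2)
       (simp add: qpoch_inf_nonzero p)
  also have "qpoch_inf p p / (qpoch_inf p p * qpoch_inf p p) = 1 / qpoch_inf p p"
    by (simp add: qpoch_inf_nonzero p)
  finally show ?thesis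
  proof (rule Lim_transform_eventually)
    show "\<forall>\<^sub>F n in sequentially.
        qpoch p p (2 * n) / (qpoch p p (nat (int n + m)) * qpoch p p (nat (int n + (- m)))) =
        qbinomial p (2 * n) (nat (int n + m))"
    \<comment> \<open>From \<open>n >= |m|\<close> on, \<open>nat\<close> truncates nothing and the
      lower index lies between \<open>0\<close> and \<open>2n\<close>, so the quotient formula
      applies.\<close>
    proof (rule eventually_sequentiallyI[of "nat \<bar>m\<bar>"])
      fix n assume "nat \<bar>m\<bar> \<le> n"
      then have le: "nat (int n + m) \<le> 2 * n" and "2 * n - nat (int n + m) = nat (int n + (- m))"
        by auto
      then show "qpoch p p (2 * n) / (qpoch p p (nat (int n + m)) * qpoch p p (nat (int n + (- m)))) =
          qbinomial p (2 * n) (nat (int n + m))"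
        using qbinomial_qpoch[OF le, of p] nz by (simp add: field_simps)
    qed
  qed
qed

lemma infsum_zero_outside_finite:
  assumes "finite B" "B \<subseteq> A"
  shows "(\<Sum>\<^sub>\<infinity>x\<in>A. if x \<in> B then f x else 0) = sum f B"
proof -
  have "(\<Sum>\<^sub>\<infinity>x\<in>A. if x \<in> B then f x else 0) = infsum f B"
    by (rule infsum_cong_neutral) (use assms in auto)
  then show ?thesis using assms by simp
qed

lemma theta_phi_product:
  assumes q: "norm q < 1"
  shows "theta_phi q = qpoch_inf (q\<^sup>2) (q\<^sup>2) * (qpoch_inf (- q) (q\<^sup>2))\<^sup>2"
proof (cases "q = 0")
  \<comment> \<open>\<open>theta_finite_sum\<close> requires \<open>q\<close> nonzero. At
    \<open>q = 0\<close> only \<open>m = 0\<close> survives, because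
    \<open>0 ^ 0 = 1\<close>.\<close>
  case True
  have "theta_phi q = (\<Sum>\<^sub>\<infinity>m\<in>UNIV. if m \<in> {0::int} then 1 else 0)"
    unfolding theta_phi_def True by (rule infsum_cong) (auto simp: power_0_left)
  then show ?thesis 
    by (subst (asm) infsum_zero_outside_finite) (simp_all add: True qpoch_inf_def)
next
  case False
  define p where "p = q\<^sup>2"
  have p: "norm p < 1" using q by (simp add: p_def norm_power power_less_one_iff)
  obtain C where C: "\<And>n i. norm (qbinomial p n i) \<le> C" "0 \<le> C"
    using qbinomial_bounded[OF p] by blast
  \<comment> \<open>Extension by zero puts all the finite sums on the common index set of
    integers.\<close>
  define f where "f n m = (if m \<in> {-int n..int n}
      then q ^ nat (m\<^sup>2) * qbinomial p (2 * n) (nat (int n + m)) else 0)" for n m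
  have "(\<lambda>n. infsum (f n) UNIV) \<longlonglongrightarrow> (\<Sum>\<^sub>\<infinity>m. q ^ nat (m\<^sup>2) * (1 / qpoch_inf p p))"
  proof (rule infsum_dominated_convergence)
    fix m :: int
    have "(\<lambda>n. q ^ nat (m\<^sup>2) * qbinomial p (2 * n) (nat (int n + m)))
        \<longlonglongrightarrow> q ^ nat (m\<^sup>2) * (1 / qpoch_inf p p)"
      by (intro tendsto_mult tendsto_const qbinomial_central_LIMSEQ p)
    then show "(\<lambda>n. f n m) \<longlonglongrightarrow> q ^ nat (m\<^sup>2) * (1 / qpoch_inf p p)"
    proof (rule Lim_transform_eventually)
      show "\<forall>\<^sub>F n in sequentially. q ^ nat (m\<^sup>2) * qbinomial p (2 * n) (nat (int n + m)) = f n m"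
        by (rule eventually_sequentiallyI[of "nat \<bar>m\<bar>"]) (auto simp: f_def)
    qed
  next
    fix n and m :: int
    show "norm (f n m) \<le> norm q ^ nat (m\<^sup>2) * C"
      using C by (auto simp: f_def norm_mult norm_power intro!: mult_left_mono)
  next
    show "(\<lambda>m::int. norm q ^ nat (m\<^sup>2) * C) summable_on UNIV"
      using q by (intro summable_on_cmult_left summable_on_theta) auto
  qed
  moreover have "infsum (f n) UNIV = (qpoch (- q) p n)\<^sup>2" for n
    unfolding f_def by (subst infsum_zero_outside_finite) (simp_all add: p_def theta_finite_sum[OF False])
  moreover have "(\<lambda>n. (qpoch (- q) p n)\<^sup>2) \<longlonglongrightarrow> (qpoch_inf (- q) p)\<^sup>2"
    by (intro tendsto_power qpoch_LIMSEQ p)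
  ultimately have "(\<Sum>\<^sub>\<infinity>m. q ^ nat (m\<^sup>2) * (1 / qpoch_inf p p)) = (qpoch_inf (- q) p)\<^sup>2"
    using LIMSEQ_unique by auto
  moreover have "(\<Sum>\<^sub>\<infinity>m. q ^ nat (m\<^sup>2) * (1 / qpoch_inf p p)) = theta_phi q * (1 / qpoch_inf p p)"
    unfolding theta_phi_def by (rule infsum_cmult_left')
  ultimately show ?thesis
    using qpoch_inf_nonzero[OF p p] by (simp add: p_def field_simps)
qed

section \<open>Generating functions of overpartitions\<close>

text \<open>Absolute summability is returned along with the value so that the product rule can be
  iterated, one kind of part at a time.\<close>

lemma has_sum_mult_Times:
  fixes f :: "'a \<Rightarrow> 'c::{real_normed_field, banach}" and g :: "'b \<Rightarrow> 'c"
  assumes f: "(f has_sum a) A" "(\<lambda>x. norm (f x)) summable_on A"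
    and g: "(g has_sum b) B" "(\<lambda>y. norm (g y)) summable_on B"
  shows "((\<lambda>(x, y). f x * g y) has_sum a * b) (A \<times> B)"
    and "(\<lambda>(x, y). norm (f x * g y)) summable_on A \<times> B"
proof -
  have "(\<lambda>x. norm (f x) * infsum (\<lambda>y. norm (g y)) B) summable_on A"
    by (intro summable_on_cmult_left f)
  then have "(\<lambda>z. norm (case z of (x, y) \<Rightarrow> f x * g y)) summable_on A \<times> B"
    by (subst Infinite_Sum.abs_summable_on_Sigma_iff)
       (auto simp: norm_mult infsum_cmult_right' abs_mult infsum_nonneg intro!: summable_on_cmult_right g)
  then show *: "(\<lambda>(x, y). norm (f x * g y)) summable_on A \<times> B"
    by (simp add: case_prod_unfold)
  show "((\<lambda>(x, y). f x * g y) has_sum a * b) (A \<times> B)"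
  proof (rule has_sum_SigmaI)
    show "(\<lambda>(x, y). f x * g y) summable_on A \<times> B"
      by (rule Infinite_Sum.abs_summable_summable) (use * in \<open>simp add: case_prod_unfold\<close>)
  qed (auto intro!: has_sum_cmult_left has_sum_cmult_right f g)
qed

text \<open>A pair \<open>(m, b)\<close> records the multiplicity of a single part and whether its
  first occurrence is overlined, which needs \<open>m > 0\<close>. The two choices of
  \<open>b\<close> contribute \<open>1 / (1 - x)\<close> and \<open>x / (1 - x)\<close>.\<close>

lemma has_sum_overlined_geometric:
  fixes x :: "'a::{real_normed_field, banach}"
  assumes "norm x < 1"
  shows "((\<lambda>(m, b). x ^ m) has_sum (1 + x) / (1 - x)) {(m, b). b \<longrightarrow> 0 < m}"
proof -
  have x1: "1 - x \<noteq> 0" using assms by auto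
  have "((\<lambda>m. x ^ m) has_sum 1 / (1 - x)) UNIV"
    by (rule norm_summable_imp_has_sum)
       (use assms in \<open>auto simp: norm_power intro!: geometric_sums summable_geometric\<close>)
  then have 1: "((\<lambda>(m, b). x ^ m) has_sum 1 / (1 - x)) ((\<lambda>m. (m, False)) ` UNIV)"
    by (subst has_sum_reindex) (auto simp: inj_on_def o_def)
  have 2: "((\<lambda>(m, b). x ^ m) has_sum x / (1 - x)) ((\<lambda>m. (m, True)) ` {1..})"
    by (subst has_sum_reindex) (use has_sum_geometric_from_1[OF assms] in \<open>auto simp: inj_on_def o_def\<close>)
  have "{(m :: nat, b). b \<longrightarrow> 0 < m} = (\<lambda>m. (m, False)) ` UNIV \<union> (\<lambda>m. (m, True)) ` {1..}"
    by (auto simp: image_iff)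
  moreover have "(1 + x) / (1 - x) = 1 / (1 - x) + x / (1 - x)"
    by (simp add: add_divide_distrib)
  ultimately show ?thesis
    using has_sum_Un_disjoint[OF 1 2] by auto
qed

text \<open>Kinds of parts are abstract, with sizes supplied separately by a weight
  (\<open>fst\<close> for coloured parts). The total size is left free, so that one sum over this
  set is the generating function.\<close>

definition overpartitions :: "'a set \<Rightarrow> ('a multiset \<times> 'a set) set" where
  "overpartitions S = {(M, Ov). set_mset M \<subseteq> S \<and> Ov \<subseteq> set_mset M}"

lemma overpartitions_mono: "S \<subseteq> T \<Longrightarrow> overpartitions S \<subseteq> overpartitions T"
  by (auto simp: overpartitions_def)

abbreviation overpartition_weight :: "('a \<Rightarrow> nat) \<Rightarrow> 'a multiset \<times> 'a set \<Rightarrow> nat" where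
  "overpartition_weight w x \<equiv> \<Sum>p\<in>#fst x. w p"

text \<open>Each new kind of part multiplies the sum by an overlined geometric series, convergent
  because its weight is positive. The field is general since the result is used at complex
  \<open>q\<close> and at the real number \<open>norm q\<close>.\<close>

lemma has_sum_overpartitions_finite:
  fixes q :: "'a::{real_normed_field, banach}" and w :: "'b \<Rightarrow> nat"
  assumes "finite S" and q: "norm q < 1" and "\<And>p. p \<in> S \<Longrightarrow> 0 < w p"
  shows "((\<lambda>x. q ^ overpartition_weight w x) has_sum (\<Prod>p\<in>S. (1 + q ^ w p) / (1 - q ^ w p)))
           (overpartitions S) \<and>
         (\<lambda>x. norm (q ^ overpartition_weight w x)) summable_on overpartitions S"
  using assms(1,3)
proof (induction S rule: finite_induct)
  case empty
  have "overpartitions ({} :: 'b set) = {({#}, {})}" by (auto simp: overpartitions_def)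
  then show ?case
    using has_sum_finite[of "{({#}, {})}" "\<lambda>x. q ^ overpartition_weight w x"] by simp
next
  case (insert p S)
  define x where "x = q ^ w p"
  have x: "norm x < 1"
    using q insert.prems[of p] by (simp add: x_def norm_power power_less_one_iff)
  define T where "T = {(m::nat, b). b \<longrightarrow> 0 < m}"
  have T: "((\<lambda>y. x ^ fst y) has_sum (1 + x) / (1 - x)) T"
    using has_sum_overlined_geometric[OF x] by (simp add: T_def case_prod_unfold)
  have nT: "(\<lambda>y. norm (x ^ fst y)) summable_on T"
    using has_sum_overlined_geometric[of "norm x"] x
    by (auto simp: T_def case_prod_unfold norm_power dest: has_sum_imp_summable)
  have IH: "((\<lambda>x. q ^ overpartition_weight w x) has_sum (\<Prod>p\<in>S. (1 + q ^ w p) / (1 - q ^ w p)))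
      (overpartitions S)" "(\<lambda>x. norm (q ^ overpartition_weight w x)) summable_on overpartitions S"
    using insert by auto
  \<comment> \<open>Split off the copies of \<open>p\<close>, recording their number and whether the first is overlined.\<close>
  define h where "h = (\<lambda>(y :: nat \<times> bool, z :: 'b multiset \<times> 'b set).
      (replicate_mset (fst y) p + fst z, if snd y then insert p (snd z) else snd z))"
  define h' where "h' = (\<lambda>u :: 'b multiset \<times> 'b set.
      ((count (fst u) p, p \<in> snd u), (filter_mset (\<lambda>r. r \<noteq> p) (fst u), snd u - {p})))"
  have h_in: "h z \<in> overpartitions (insert p S)" if "z \<in> T \<times> overpartitions S" for z
    using that by (auto simp: h_def T_def overpartitions_def split: if_splits)
  have h'_in: "h' u \<in> T \<times> overpartitions S" if "u \<in> overpartitions (insert p S)" for u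
    using that by (auto simp: h'_def T_def overpartitions_def)
  have hh': "h (h' u) = u" if "u \<in> overpartitions (insert p S)" for u
    by (cases u) (auto simp: h_def h'_def intro!: multiset_eqI)
  have h'h: "h' (h z) = z" if "z \<in> T \<times> overpartitions S" for z
  proof -
    obtain m b M Ov where z: "z = ((m, b), (M, Ov))" by (metis prod.collapse)
    with that insert.hyps have "p \<notin># M" "p \<notin> Ov" by (auto simp: overpartitions_def)
    then show ?thesis
      by (auto simp: z h_def h'_def not_in_iff filter_mset_eq_conv intro!: multiset_eqI)
  qed
  have wt: "q ^ overpartition_weight w (h z) = x ^ fst (fst z) * q ^ overpartition_weight w (snd z)" for z
    by (cases z) (simp add: h_def x_def power_add power_mult[symmetric] mult.commute)
  have "((\<lambda>u. q ^ overpartition_weight w u) has_sum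
       (1 + x) / (1 - x) * (\<Prod>p\<in>S. (1 + q ^ w p) / (1 - q ^ w p))) (overpartitions (insert p S))
     \<longleftrightarrow> ((\<lambda>(y, z). x ^ fst y * q ^ overpartition_weight w z) has_sum
       (1 + x) / (1 - x) * (\<Prod>p\<in>S. (1 + q ^ w p) / (1 - q ^ w p))) (T \<times> overpartitions S)"
    by (rule has_sum_reindex_bij_witness[of _ h h'])
       (simp_all add: hh' h'h h_in h'_in case_prod_unfold flip: wt)
  moreover have "(\<lambda>u. norm (q ^ overpartition_weight w u)) summable_on (overpartitions (insert p S))
     \<longleftrightarrow> (\<lambda>(y, z). norm (x ^ fst y * q ^ overpartition_weight w z)) summable_on (T \<times> overpartitions S)"
    by (rule summable_on_reindex_bij_witness[of _ h h'])
       (simp_all add: hh' h'h h_in h'_in case_prod_unfold flip: wt)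
  ultimately show ?case
    using has_sum_mult_Times[OF T nT IH] insert.hyps by (simp add: x_def)
qed

lemma finite_subset_incseq:
  assumes "incseq S" "finite F" "F \<subseteq> (\<Union>N. S N)"
  shows "\<exists>N. F \<subseteq> S N"
  using assms(2,3)
proof (induction F rule: finite_induct)
  case (insert x F)
  then obtain M N where "x \<in> S M" "F \<subseteq> S N" by auto
  then have "insert x F \<subseteq> S (max M N)"
    using incseqD[OF assms(1), of M "max M N"] incseqD[OF assms(1), of N "max M N"] by auto
  then show ?case ..
qed simp

text \<open>Finitely many overpartitions involve only finitely many kinds of parts, and these all
  lie in a single \<open>S N\<close>.\<close>

lemma finite_subset_overpartitions_incseq:
  assumes "incseq S" "finite F" "F \<subseteq> overpartitions (\<Union>N. S N)"
  obtains N :: nat where "F \<subseteq> overpartitions (S N)"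
proof -
  let ?U = "\<Union>x\<in>F. set_mset (fst x)"
  have "finite ?U" using assms by simp
  moreover have "?U \<subseteq> (\<Union>N. S N)"
    using assms by (fastforce simp: overpartitions_def)
  ultimately obtain N where "?U \<subseteq> S N"
    using finite_subset_incseq[OF assms(1)] by blast
  then have "F \<subseteq> overpartitions (S N)"
    using assms(3) by (fastforce simp: overpartitions_def)
  then show ?thesis by (rule that)
qed

text \<open>The kinds of parts are exhausted by finite sets. The products at \<open>norm q\<close>
  converge, hence are bounded, and they bound all finite sums of norms; dominated convergence then
  identifies the value. This is why \<open>lim\<close> is assumed on the whole disc and not only at
  the given \<open>q\<close>.\<close>

lemma has_sum_overpartitions_limit:
  fixes w :: "'b \<Rightarrow> nat" and S :: "nat \<Rightarrow> 'b set" and L :: "complex \<Rightarrow> complex"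
  assumes S: "incseq S" "\<And>N. finite (S N)"
    and pos: "\<And>N p. p \<in> S N \<Longrightarrow> 0 < w p"
    and lim: "\<And>q. norm q < 1 \<Longrightarrow> (\<lambda>N. \<Prod>p\<in>S N. (1 + q ^ w p) / (1 - q ^ w p)) \<longlonglongrightarrow> L q"
    and q: "norm q < 1"
  shows "((\<lambda>x. q ^ overpartition_weight w x) has_sum L q) (overpartitions (\<Union>N. S N))"
proof -
  let ?A = "overpartitions (\<Union>N. S N)" and ?g = "\<lambda>x. q ^ overpartition_weight w x"
  let ?P = "\<lambda>q N. \<Prod>p\<in>S N. (1 + q ^ w p) / (1 - q ^ w p)"
  define r where "r = norm q"
  have r: "norm r < 1" "norm (of_real r :: complex) < 1" "0 \<le> r" using q by (auto simp: r_def)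
  have "Bseq (?P (of_real r :: complex))"
    by (rule convergent_imp_Bseq[OF convergentI[OF lim[OF r(2)]]])
  then obtain B where B: "norm (?P (of_real r :: complex) N) \<le> B" for N
    by (auto simp: Bseq_def)
  \<comment> \<open>\<open>lim\<close> concerns complex arguments, whereas the sums of norms are
    compared with the real product.\<close>
  have B': "?P r N \<le> B" for N
  proof -
    have "?P (of_real r :: complex) N = of_real (?P r N)" by simp
    with B[of N] have "\<bar>?P r N\<bar> \<le> B" by (simp only: norm_of_real)
    then show ?thesis by linarith
  qed
  have abs: "(\<lambda>x. norm (?g x)) summable_on ?A"
  proof (rule nonneg_bdd_above_summable_on)
    show "bdd_above (sum (\<lambda>x. norm (?g x)) ` {F. F \<subseteq> ?A \<and> finite F})"
    proof (rule bdd_aboveI2)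
      fix F assume "F \<in> {F. F \<subseteq> ?A \<and> finite F}"
      then obtain N where N: "finite F" "F \<subseteq> overpartitions (S N)"
        using finite_subset_overpartitions_incseq[OF S(1)] by auto
      have sN: "((\<lambda>x. norm (?g x)) has_sum ?P r N) (overpartitions (S N))"
        using has_sum_overpartitions_finite[OF S(2) r(1), of N w] pos by (simp add: norm_power r_def)
      have "sum (\<lambda>x. norm (?g x)) F \<le> ?P r N"
        by (rule has_sum_mono_neutral[OF has_sum_finite[OF N(1)] sN]) (use N in auto)
      then show "sum (\<lambda>x. norm (?g x)) F \<le> B" using B' order_trans by blast
    qed
  qed simp
  have "(\<lambda>N. infsum (\<lambda>x. if x \<in> overpartitions (S N) then ?g x else 0) ?A) \<longlonglongrightarrow> infsum ?g ?A"
  proof (rule infsum_dominated_convergence[OF _ _ abs])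
    fix x assume "x \<in> ?A"
    then obtain N where N: "x \<in> overpartitions (S N)"
      using finite_subset_overpartitions_incseq[OF S(1), of "{x}"] by auto
    have "\<forall>\<^sub>F n in sequentially. ?g x = (if x \<in> overpartitions (S n) then ?g x else 0)"
    proof (rule eventually_sequentiallyI)
      fix n assume "N \<le> n"
      then have "S N \<subseteq> S n" using S(1) by (simp add: incseqD)
      then show "?g x = (if x \<in> overpartitions (S n) then ?g x else 0)"
        using N overpartitions_mono by auto
    qed
    then show "(\<lambda>n. if x \<in> overpartitions (S n) then ?g x else 0) \<longlonglongrightarrow> ?g x"
      by (rule Lim_transform_eventually[OF tendsto_const])
  qed auto
  moreover have "infsum (\<lambda>x. if x \<in> overpartitions (S N) then ?g x else 0) ?A = ?P q N" for N
  proof -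
    have "overpartitions (S N) \<subseteq> ?A" by (intro overpartitions_mono) auto
    then have "infsum (\<lambda>x. if x \<in> overpartitions (S N) then ?g x else 0) ?A =
        infsum ?g (overpartitions (S N))"
      by (intro infsum_cong_neutral) auto
    also have "\<dots> = ?P q N"
      using has_sum_overpartitions_finite[OF S(2) q, of N w] pos by (blast intro: infsumI)
    finally show ?thesis .
  qed
  ultimately have "infsum ?g ?A = L q" using lim[OF q] LIMSEQ_unique by auto
  then show ?thesis
    using abs Infinite_Sum.abs_summable_summable[of ?g ?A] by (metis has_sum_infsum)
qed

section \<open>The generating function of the coloured overpartitions\<close>

lemma coloured_overpartitions_eq:
  "coloured_overpartitions k n =
     {x \<in> overpartitions {p. admissible_part k p}. overpartition_weight fst x = n}"
  by (auto simp: coloured_overpartitions_def overpartitions_def)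

definition overpartition_factor :: "'a::field \<Rightarrow> nat \<Rightarrow> 'a" where
  "overpartition_factor q v = (1 + q ^ v) / (1 - q ^ v)"

lemma prod_overpartition_factor_progression:
  "(\<Prod>j<n. overpartition_factor q (a + b * j)) = qpoch (- (q ^ a)) (q ^ b) n / qpoch (q ^ a) (q ^ b) n"
  by (simp add: overpartition_factor_def qpoch_def prod_dividef power_add power_mult)

text \<open>Cutting at \<open>2 * k * N\<close>, a multiple of the period, leaves complete
  progressions: all sizes, the first \<open>N\<close> multiples of \<open>2k\<close>, and the first
  \<open>N\<close> odd multiples of \<open>k\<close>. They are written as \<open>a + b * j\<close>
  to match \<open>prod_overpartition_factor_progression\<close>.\<close>

lemma admissible_parts_upto:
  assumes k: "0 < k"
  shows "{p. admissible_part k p \<and> fst p \<le> 2 * k * N} =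
    (\<lambda>v. (v, False)) ` ((\<lambda>j. 1 + 1 * j) ` {..<2 * k * N} - (\<lambda>j. 2 * k + 2 * k * j) ` {..<N}) \<union>
    (\<lambda>v. (v, True)) ` (\<lambda>j. k + 2 * k * j) ` {..<N}" (is "?L = ?R")
proof -
  have mult: "v \<in> (\<lambda>j. 2 * k + 2 * k * j) ` {..<N} \<longleftrightarrow> 2 * k dvd v"
    if v: "0 < v" "v \<le> 2 * k * N" for v
  proof
    assume "2 * k dvd v"
    then obtain j where j: "v = 2 * k * j" by (elim dvdE)
    with v obtain i where "j = Suc i" by (cases j) auto
    moreover have "j \<le> N" using j v k by simp
    ultimately show "v \<in> (\<lambda>j. 2 * k + 2 * k * j) ` {..<N}"
      using j by (intro image_eqI[of _ _ i]) auto
  qed (auto simp flip: mult_Suc_right)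
  have half: "v \<in> (\<lambda>j. k + 2 * k * j) ` {..<N} \<longleftrightarrow> v mod (2 * k) = k \<and> v \<le> 2 * k * N" for v
  proof
    assume "v \<in> (\<lambda>j. k + 2 * k * j) ` {..<N}"
    then obtain j where j: "v = k + 2 * k * j" "j < N" by auto
    then have "2 * k * Suc j \<le> 2 * k * N" by (intro mult_le_mono2) auto
    with j k show "v mod (2 * k) = k \<and> v \<le> 2 * k * N" by simp
  next
    assume v: "v mod (2 * k) = k \<and> v \<le> 2 * k * N"
    then have e: "v = k + 2 * k * (v div (2 * k))"
      by (metis mult_div_mod_eq add.commute)
    with v k have "2 * k * (v div (2 * k)) < 2 * k * N" by linarith
    then have "v div (2 * k) < N" by simp
    with e show "v \<in> (\<lambda>j. k + 2 * k * j) ` {..<N}" by blast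
  qed
  \<comment> \<open>Sizes allowed in the second colour meet the remaining admissibility conditions
    automatically, since \<open>k\<close> is nonzero modulo \<open>2k\<close>.\<close>
  have half_pos: "0 < v \<and> \<not> 2 * k dvd v" if "v mod (2 * k) = k" for v
    using that k by (auto simp: dvd_eq_mod_eq_0 intro: gr0I)
  have all: "v \<in> (\<lambda>j. 1 + 1 * j) ` {..<M} \<longleftrightarrow> 0 < v \<and> v \<le> M" for v M :: nat
    by (cases v) (auto simp: image_iff)
  show ?thesis
  proof (rule set_eqI)
    fix p :: "nat \<times> bool"
    obtain v b where p: "p = (v, b)" by (cases p)
    show "p \<in> ?L \<longleftrightarrow> p \<in> ?R"
      using mult[of v] half[of v] half_pos[of v] all[of v "2 * k * N"] unfolding p
      by (cases b) (auto simp: admissible_part_def simp del: mult_1)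
  qed
qed

lemma prod_admissible_parts_upto:
  fixes q :: complex
  assumes k: "0 < k" and q: "norm q < 1"
  shows "(\<Prod>p | admissible_part k p \<and> fst p \<le> 2 * k * N. (1 + q ^ fst p) / (1 - q ^ fst p)) =
    qpoch (- q) q (2 * k * N) / qpoch q q (2 * k * N) /
    (qpoch (- ((q ^ k)\<^sup>2)) ((q ^ k)\<^sup>2) N / qpoch ((q ^ k)\<^sup>2) ((q ^ k)\<^sup>2) N) *
    (qpoch (- (q ^ k)) ((q ^ k)\<^sup>2) N / qpoch (q ^ k) ((q ^ k)\<^sup>2) N)"
proof -
  let ?F = "overpartition_factor q"
  let ?A = "(\<lambda>j. 1 + 1 * j) ` {..<2 * k * N}" and ?B = "(\<lambda>j. 2 * k + 2 * k * j) ` {..<N}"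
    and ?C = "(\<lambda>j. k + 2 * k * j) ` {..<N}"
  have q2k: "q ^ (2 * k) = (q ^ k)\<^sup>2" by (simp add: power_mult[symmetric] mult.commute)
  have "?B \<subseteq> ?A"
  proof
    fix v assume "v \<in> ?B"
    then obtain j where j: "v = 2 * k * Suc j" "j < N" by auto
    then have "2 * k * Suc j \<le> 2 * k * N" by (intro mult_le_mono2) auto
    with j k show "v \<in> ?A" by (intro image_eqI[of _ _ "v - 1"]) auto
  qed
  then have AB: "prod ?F ?A = prod ?F (?A - ?B) * prod ?F ?B"
    by (intro prod.subset_diff) auto
  \<comment> \<open>Removing the multiples of \<open>2k\<close> becomes a division, so their factors
    must not vanish; \<open>|q^v| < 1\<close> excludes \<open>q^v = 1\<close> and
    \<open>q^v = -1\<close>.\<close>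
  have factor_nz: "?F v \<noteq> 0" if "0 < v" for v
  proof -
    have "norm (q ^ v) < 1" using q that by (simp add: norm_power power_less_one_iff)
    then have "1 + q ^ v \<noteq> 0" "1 - q ^ v \<noteq> 0"
      by (metis add_eq_0_iff norm_minus_cancel norm_one less_irrefl) 
         (metis \<open>norm (q ^ v) < 1\<close> eq_iff_diff_eq_0 norm_one less_irrefl)
    then show ?thesis by (simp add: overpartition_factor_def)
  qed
  then have "prod ?F ?B \<noteq> 0" using k by auto
  with AB have AB': "prod ?F (?A - ?B) = prod ?F ?A / prod ?F ?B" by simp
  have "(\<Prod>p | admissible_part k p \<and> fst p \<le> 2 * k * N. (1 + q ^ fst p) / (1 - q ^ fst p)) =
      prod ?F (?A - ?B) * prod ?F ?C"
    unfolding admissible_parts_upto[OF k]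
    by (subst prod.union_disjoint)
       (auto simp: prod.reindex inj_on_def overpartition_factor_def simp del: image_diff_subset)
  also have "\<dots> = prod ?F ?A / prod ?F ?B * prod ?F ?C" by (simp only: AB')
  also have "prod ?F ?A = (\<Prod>j<2 * k * N. ?F (1 + 1 * j))"
    by (subst prod.reindex) (auto simp: inj_on_def)
  also have "prod ?F ?B = (\<Prod>j<N. ?F (2 * k + 2 * k * j))"
    using k by (subst prod.reindex) (auto simp: inj_on_def)
  also have "prod ?F ?C = (\<Prod>j<N. ?F (k + 2 * k * j))"
    using k by (subst prod.reindex) (auto simp: inj_on_def)
  finally show ?thesis
    unfolding prod_overpartition_factor_progression by (simp add: q2k)
qed

lemma prod_admissible_parts_LIMSEQ:
  fixes q :: complex
  assumes k: "0 < k" and q: "norm q < 1"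
  shows "(\<lambda>N. \<Prod>p | admissible_part k p \<and> fst p \<le> 2 * k * N. (1 + q ^ fst p) / (1 - q ^ fst p))
    \<longlonglongrightarrow> qpoch_inf (- q) q / qpoch_inf q q * theta_phi (q ^ k)"
proof -
  define Q where "Q = q ^ k"
  have Q: "norm Q < 1" and Q2: "norm (Q\<^sup>2) < 1"
    using q k by (simp_all add: Q_def norm_power power_less_one_iff)
  have sub: "filterlim (\<lambda>N. 2 * k * N) at_top sequentially"
    using k by (auto intro!: filterlim_subseq strict_monoI)
  have "(\<lambda>N. qpoch (- q) q (2 * k * N) / qpoch q q (2 * k * N) /
      (qpoch (- (Q\<^sup>2)) (Q\<^sup>2) N / qpoch (Q\<^sup>2) (Q\<^sup>2) N) * (qpoch (- Q) (Q\<^sup>2) N / qpoch Q (Q\<^sup>2) N))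
    \<longlonglongrightarrow> qpoch_inf (- q) q / qpoch_inf q q /
      (qpoch_inf (- (Q\<^sup>2)) (Q\<^sup>2) / qpoch_inf (Q\<^sup>2) (Q\<^sup>2)) * (qpoch_inf (- Q) (Q\<^sup>2) / qpoch_inf Q (Q\<^sup>2))"
    using q Q Q2
    by (intro tendsto_divide tendsto_mult qpoch_LIMSEQ filterlim_compose[OF qpoch_LIMSEQ sub])
       (simp_all add: qpoch_inf_nonzero)
  also have "qpoch_inf (- q) q / qpoch_inf q q /
      (qpoch_inf (- (Q\<^sup>2)) (Q\<^sup>2) / qpoch_inf (Q\<^sup>2) (Q\<^sup>2)) * (qpoch_inf (- Q) (Q\<^sup>2) / qpoch_inf Q (Q\<^sup>2)) =
      qpoch_inf (- q) q / qpoch_inf q q * theta_phi Q"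
  proof -
    \<comment> \<open>Euler's identity at \<open>Q^2\<close>, with \<open>(Q^2;Q^4)\<close> split
      into \<open>(Q;Q^2) (-Q;Q^2)\<close>. It replaces one of the two factors
      \<open>(-Q;Q^2)\<close> of \<open>theta_phi Q\<close> by the reciprocal of
      \<open>(Q;Q^2) (-Q^2;Q^2)\<close>.\<close>
    have "qpoch_inf Q (Q\<^sup>2) * qpoch_inf (- Q) (Q\<^sup>2) * qpoch_inf (- (Q\<^sup>2)) (Q\<^sup>2) = 1"
      using euler_odd_distinct[OF Q2] qpoch_inf_plus_minus[OF Q] by simp
    moreover have "qpoch_inf Q (Q\<^sup>2) \<noteq> 0" "qpoch_inf (- (Q\<^sup>2)) (Q\<^sup>2) \<noteq> 0" "qpoch_inf q q \<noteq> 0"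
      using q Q Q2 by (simp_all add: qpoch_inf_nonzero)
    ultimately have "qpoch_inf (- Q) (Q\<^sup>2) = 1 / (qpoch_inf Q (Q\<^sup>2) * qpoch_inf (- (Q\<^sup>2)) (Q\<^sup>2))"
      by (simp add: field_simps)
    then have "theta_phi Q = qpoch_inf (Q\<^sup>2) (Q\<^sup>2) *
        (qpoch_inf (- Q) (Q\<^sup>2) * (1 / (qpoch_inf Q (Q\<^sup>2) * qpoch_inf (- (Q\<^sup>2)) (Q\<^sup>2))))"
      using theta_phi_product[OF Q] by (simp only: power2_eq_square)
    then show ?thesis by (simp add: mult_ac)
  qed
  finally show ?thesis
    unfolding prod_admissible_parts_upto[OF k q] Q_def .
qed

lemma has_sum_admissible_overpartitions:
  fixes q :: complex
  assumes k: "0 < k" and q: "norm q < 1"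
  shows "((\<lambda>x. q ^ overpartition_weight fst x) has_sum
    qpoch_inf (- q) q / qpoch_inf q q * theta_phi (q ^ k)) (overpartitions {p. admissible_part k p})"
proof -
  define S where "S N = {p. admissible_part k p \<and> fst p \<le> 2 * k * N}" for N
  have "((\<lambda>x. q ^ overpartition_weight fst x) has_sum
    qpoch_inf (- q) q / qpoch_inf q q * theta_phi (q ^ k)) (overpartitions (\<Union>N. S N))"
  proof (rule has_sum_overpartitions_limit)
    show "incseq S"
    proof (rule incseq_SucI)
      show "S N \<le> S (Suc N)" for N by (auto simp: S_def)
    qed
    show "finite (S N)" for N
      unfolding S_def admissible_parts_upto[OF k] by auto
    show "0 < fst p" if "p \<in> S N" for N p
      using that by (simp add: S_def admissible_part_def)
    show "(\<lambda>N. \<Prod>p\<in>S N. (1 + q ^ fst p) / (1 - q ^ fst p)) \<longlonglongrightarrow>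
        qpoch_inf (- q) q / qpoch_inf q q * theta_phi (q ^ k)" if "norm q < 1" for q
      using prod_admissible_parts_LIMSEQ[OF k that] by (simp add: S_def)
  qed (rule q)
  also have "(\<Union>N. S N) = {p. admissible_part k p}"
  proof -
    \<comment> \<open>A part of size \<open>v\<close> is reached by stage \<open>N = v\<close>,
      because \<open>v <= 2 * k * v\<close>.\<close>
    have "p \<in> S (fst p)" if "admissible_part k p" for p
      using that k by (simp add: S_def trans_le_add1)
    then show ?thesis unfolding S_def by blast
  qed
  finally show ?thesis .
qed

text \<open>An infinite fibre would make the generating function diverge at \<open>q = 1/2\<close>.\<close>

lemma finite_coloured_overpartitions:
  assumes k: "0 < k"
  shows "finite (coloured_overpartitions k n)"
proof (rule ccontr)
  assume inf: "infinite (coloured_overpartitions k n)"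
  have "(\<lambda>x. (1 / 2 :: complex) ^ overpartition_weight fst x) summable_on
      overpartitions {p. admissible_part k p}"
    by (rule has_sum_imp_summable[OF has_sum_admissible_overpartitions[OF k]]) simp
  then have "(\<lambda>x. (1 / 2 :: complex) ^ overpartition_weight fst x) summable_on
      coloured_overpartitions k n"
    by (rule summable_on_subset) (auto simp: coloured_overpartitions_eq)
  then have "(\<lambda>x. (1 / 2 :: complex) ^ n) summable_on coloured_overpartitions k n"
    by (rule summable_on_cong[THEN iffD1, rotated]) (auto simp: coloured_overpartitions_eq)
  then have "(\<lambda>x. norm ((1 / 2 :: complex) ^ n)) summable_on coloured_overpartitions k n"
    by (simp only: summable_on_iff_abs_summable_on_complex)
  then show False
    using infsum_diverge_constant[OF inf, of "norm ((1 / 2 :: complex) ^ n)"] by simp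
qed

text \<open>The sum over all admissible overpartitions is grouped by total size: tagging each with
  its weight identifies them with a disjoint union of finite fibres, and the n-th fibre contributes
  its cardinality times \<open>q^n\<close>.\<close>

lemma sums_card_coloured_overpartitions:
  fixes q :: complex
  assumes k: "0 < k" and q: "norm q < 1"
  shows "(\<lambda>n. of_nat (card (coloured_overpartitions k n)) * q ^ n) sums
    (qpoch_inf (- q) q / qpoch_inf q q * theta_phi (q ^ k))"
proof (rule has_sum_imp_sums, rule has_sum_SigmaD)
  let ?C = "coloured_overpartitions k" and ?A = "overpartitions {p. admissible_part k p}"
  let ?L = "qpoch_inf (- q) q / qpoch_inf q q * theta_phi (q ^ k)"
  have "((\<lambda>x. q ^ overpartition_weight fst x) has_sum ?L) ?A \<longleftrightarrow>
      ((\<lambda>z. q ^ fst z) has_sum ?L) (Sigma UNIV ?C)"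
    by (rule has_sum_reindex_bij_witness[of _ snd "\<lambda>x. (overpartition_weight fst x, x)"])
       (auto simp: coloured_overpartitions_eq)
  then show "((\<lambda>z. q ^ fst z) has_sum ?L) (Sigma UNIV ?C)"
    using has_sum_admissible_overpartitions[OF k q] by blast
  show "((\<lambda>y. q ^ fst (n, y)) has_sum of_nat (card (?C n)) * q ^ n) (?C n)" for n
    by (intro has_sum_finiteI) (simp_all add: finite_coloured_overpartitions[OF k])
qed

theorem theorem1:
  fixes k :: nat and g :: "nat \<Rightarrow> complex"
  assumes "0 < k"
    and "\<forall>q::complex. norm q < 1 \<longrightarrow>
           (\<lambda>n. g n * q ^ n) sums
             (qpoch_inf (- q) q / qpoch_inf q q * theta_phi (q ^ k))"
  shows "\<forall>n. g n = of_nat (card (coloured_overpartitions k n))"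
proof -
  let ?L = "\<lambda>q. qpoch_inf (- q) q / qpoch_inf q q * theta_phi (q ^ k)"
  \<comment> \<open>The unit disc is a neighbourhood of \<open>0\<close>, so both series are power
    series expansions of \<open>?L\<close> there, and uniqueness of the expansion equates their
    coefficients.\<close>
  have disc: "\<forall>\<^sub>F q in nhds (0 :: complex). norm q < 1"
    using eventually_nhds_in_open[of "ball 0 1" "0 :: complex"] by simp
  have "?L has_fps_expansion Abs_fps g"
    by (rule has_fps_expansionI, rule eventually_mono[OF disc]) (use assms(2) in simp)
  moreover have "?L has_fps_expansion Abs_fps (\<lambda>n. of_nat (card (coloured_overpartitions k n)))"
    by (rule has_fps_expansionI, rule eventually_mono[OF disc])
       (use sums_card_coloured_overpartitions[OF assms(1)] in simp)
  ultimately have "Abs_fps g = Abs_fps (\<lambda>n. of_nat (card (coloured_overpartitions k n)))"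
    by (rule fps_expansion_unique_complex)
  then show ?thesis by (simp add: fps_eq_iff)
qed

end
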